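(* Consider the problem $$\text{(P)}\quad \min_{x_1,\dots,x_N}\ \sum_{i\in\mathcal I} f_i(x_i)\quad\text{s.t.}\quad \sum_{i\in\mathcal I}\big(a_i^{m\top}x_i+b_i^m\big)\le 0,\quad m\in\mathcal M,$$ and the problem $$\text{(R)}\quad \min_{x,\,y^1,\dots,y^M}\ \sum_{i\in\mathcal I} f_i(x_i)\quad\text{s.t.}\quad A^{m\top}x+Ly^m+b^m\le 0,\quad m\in\mathcal M.$$ The two problems are equivalent in the sense that: 1) for any feasible solution $(x',y')$ of (R), $x'$ is a feasible solution of (P); 2) for any feasible solution $x'$ of (P), there exists $y'\in\mathbb R^{NM}$ such that $(x',y')$ is a feasible solution of (R); 3) the two problems have the same cost function.
   Context: $\mathcal I=\{1,\dots,N\}$, $\mathcal M=\{1,\dots,M\}$; $a_i^m,x_i\in\mathbb R^{d_i}$, $b_i^m\in\mathbb R$, $f_i:\mathbb R^{d_i}\to\mathbb R$. $x=[x_1;\dots;x_N]$, $b^m=(b_1^m,\dots,b_N^m)$, $A^m=\mathrm{blkdiag}(a_1^m,\dots,a_N^m)\in\mathbb R^{(\sum_i d_i)\times N}$, $y^m=(y_1^m,\dots,y_N^m)\in\mathbb R^N$, $y=[y^1;\dots;y^M]\in\mathbb R^{NM}$. $L$ is the Laplacian matrix of a connected undirected graph $\mathcal G=(\mathcal I,E)$. Vector inequalities are entrywise. *)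

theory Defs
  imports "Jordan_Normal_Form.Matrix" "Graph_Theory.Digraph_Component"
begin

(* Index sets are 0-based: the agents are {..<N}, the constraints {..<M}.  Families indexed by
   them are functions on nat, whose values outside the index set are never used.  Vectors and
   matrices carry their dimensions, so that the block sizes d i can depend on i. *)

primrec stack_vec :: "(nat \<Rightarrow> 'a vec) \<Rightarrow> nat \<Rightarrow> 'a vec" where
  "stack_vec v 0 = vNil"
| "stack_vec v (Suc n) = stack_vec v n @\<^sub>v v n"

(* The i-th block of a vector partitioned into consecutive blocks of sizes d 0, d 1, ... *)
definition vec_block :: "(nat \<Rightarrow> nat) \<Rightarrow> 'a vec \<Rightarrow> nat \<Rightarrow> 'a vec" where
  "vec_block d v i = vec (d i) (\<lambda>k. v $ ((\<Sum>j<i. d j) + k))"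

(* The next three facts show that stack_vec and vec_block are mutually inverse bijections
   between families of blocks and vectors of dimension d 0 + ... + d (n - 1). *)

lemma stack_vec_carrier:
  assumes "\<forall>i<n. v i \<in> carrier_vec (d i)"
  shows "stack_vec v n \<in> carrier_vec (\<Sum>i<n. d i)"
  using assms by (induction n) auto

lemma vec_block_stack_vec:
  assumes "\<forall>i<n. v i \<in> carrier_vec (d i)" and "i < n"
  shows "vec_block d (stack_vec v n) i = v i"
  using assms
proof (induction n)
  case 0
  then show ?case by simp
next
  case (Suc n)
  have dim: "dim_vec (stack_vec v n) = (\<Sum>j<n. d j)"
    using stack_vec_carrier[of n v d] Suc.prems(1) by auto
  show ?case
  proof (cases "i = n")
    case True
    with Suc.prems dim show ?thesis
      by (intro eq_vecI) (auto simp: vec_block_def)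
  next
    case False
    with Suc.prems have i: "i < n" by simp
    have "(\<Sum>j<i. d j) + k < (\<Sum>j<n. d j)" if "k < d i" for k
    proof -
      have "(\<Sum>j<Suc i. d j) \<le> (\<Sum>j<n. d j)"
        using i by (intro sum_mono2) auto
      with that show ?thesis by simp
    qed
    then have "vec_block d (stack_vec v (Suc n)) i = vec_block d (stack_vec v n) i"
      by (intro eq_vecI) (auto simp: vec_block_def dim trans_less_add1)
    with Suc.IH Suc.prems(1) i show ?thesis by simp
  qed
qed

lemma stack_vec_vec_block:
  assumes "v \<in> carrier_vec (\<Sum>i<n. d i)"
  shows "stack_vec (vec_block d v) n = v"
proof -
  have "stack_vec (vec_block d v) k = vec (\<Sum>i<k. d i) (\<lambda>j. v $ j)" for k
  proof (induction k)
    case 0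
    then show ?case by (intro eq_vecI) auto
  next
    case (Suc k)
    then show ?case by (intro eq_vecI) (auto simp: vec_block_def)
  qed
  with assms show ?thesis by (intro eq_vecI) auto
qed

(* Degree matrix minus adjacency matrix.  An undirected graph is a symmetric loop-free digraph
   without parallel arcs, one arc in each direction per edge, so out_degree is the degree. *)
definition laplacian_mat :: "nat \<Rightarrow> (nat, 'e) pre_digraph \<Rightarrow> real mat" where
  "laplacian_mat N G = mat N N (\<lambda>(i, j).
     (if i = j then real (out_degree G i) else 0) - (if i \<rightarrow>\<^bsub>G\<^esub> j then 1 else 0))"

definition blkdiag :: "nat \<Rightarrow> (nat \<Rightarrow> nat) \<Rightarrow> (nat \<Rightarrow> real vec) \<Rightarrow> real mat" where
  "blkdiag N d a = diag_block_mat (map (\<lambda>i. mat_of_cols (d i) [a i]) [0..<N])"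

lemma blkdiag_carrier: "blkdiag N d a \<in> carrier_mat (\<Sum>i<N. d i) N"
proof
  show "dim_row (blkdiag N d a) = (\<Sum>i<N. d i)"
    by (simp add: blkdiag_def dim_diag_block_mat o_def sum_list_distinct_conv_sum_set atLeast0LessThan)
  show "dim_col (blkdiag N d a) = N"
    by (simp add: blkdiag_def dim_diag_block_mat o_def sum_list_triv)
qed

definition feasible_P ::
  "nat \<Rightarrow> nat \<Rightarrow> (nat \<Rightarrow> nat) \<Rightarrow> (nat \<Rightarrow> nat \<Rightarrow> real vec) \<Rightarrow> (nat \<Rightarrow> nat \<Rightarrow> real) \<Rightarrow>
   (nat \<Rightarrow> real vec) \<Rightarrow> bool" where
  "feasible_P N M d a b x \<longleftrightarrow>
     (\<forall>i<N. x i \<in> carrier_vec (d i)) \<and>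
     (\<forall>m<M. (\<Sum>i<N. a m i \<bullet> x i + b m i) \<le> 0)"

definition cost_P :: "nat \<Rightarrow> (nat \<Rightarrow> real vec \<Rightarrow> real) \<Rightarrow> (nat \<Rightarrow> real vec) \<Rightarrow> real" where
  "cost_P N f x = (\<Sum>i<N. f i (x i))"

(* The order on vectors is the entrywise one. *)
definition feasible_R ::
  "nat \<Rightarrow> nat \<Rightarrow> (nat \<Rightarrow> nat) \<Rightarrow> (nat \<Rightarrow> nat \<Rightarrow> real vec) \<Rightarrow> (nat \<Rightarrow> nat \<Rightarrow> real) \<Rightarrow>
   real mat \<Rightarrow> real vec \<Rightarrow> real vec \<Rightarrow> bool" where
  "feasible_R N M d a b L x y \<longleftrightarrow>
     x \<in> carrier_vec (\<Sum>i<N. d i) \<and> y \<in> carrier_vec (N * M) \<and>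
     (\<forall>m<M. transpose_mat (blkdiag N d (a m)) *\<^sub>v x + L *\<^sub>v vec_block (\<lambda>_. N) y m + vec N (b m)
              \<le> 0\<^sub>v N)"

definition cost_R ::
  "nat \<Rightarrow> (nat \<Rightarrow> nat) \<Rightarrow> (nat \<Rightarrow> real vec \<Rightarrow> real) \<Rightarrow> real vec \<Rightarrow> real vec \<Rightarrow> real" where
  "cost_R N d f x y = (\<Sum>i<N. f i (vec_block d x i))"

end

(* Symmetry of the Laplacian L makes the entries of L y sum to 0, so summing the N rows of each
   constraint of (R) gives the constraint of (P).  Conversely, the image of L consists of all vectors
   with zero sum: L + J, with J the all-ones matrix, is nonsingular because the quadratic form of L is
   a sum of squares over the edges and vanishes only on constant vectors, and a solution of
   (L + J) y = c with c of zero sum has zero sum itself.  So L y can replace the entries of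
   A^T x + b by their common average, which is nonpositive when x is feasible for (P). *)
theory Submission
  imports Defs "Jordan_Normal_Form.Determinant"
begin

text \<open>\<open>diag_block_mat\<close> recurses on the head of its list, whereas
  \<open>stack_vec\<close> appends at the end. Splitting off the last block lets both follow the
  same induction.\<close>

lemma blkdiag_Suc:
  "blkdiag (Suc n) d a =
     four_block_mat (blkdiag n d a) (0\<^sub>m (\<Sum>i<n. d i) 1) (0\<^sub>m (d n) n) (mat_of_cols (d n) [a n])"
  using blkdiag_carrier[of n d a]
  by (simp add: blkdiag_def diag_block_mat_last Let_def del: diag_block_mat.simps)

text \<open>The zero off-diagonal blocks decouple the agents, so each induction step merely appends
  the entry contributed by the new block.\<close>

lemma transpose_blkdiag_mult_stack_vec:
  assumes "\<forall>i<n. a i \<in> carrier_vec (d i)" and "\<forall>i<n. x i \<in> carrier_vec (d i)"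
  shows "transpose_mat (blkdiag n d a) *\<^sub>v stack_vec x n = vec n (\<lambda>i. a i \<bullet> x i)"
  using assms
proof (induction n)
  case 0
  show ?case by (intro eq_vecI) (auto simp: blkdiag_def)
next
  case (Suc n)
  let ?B = "blkdiag n d a" and ?C = "mat_of_cols (d n) [a n]" and ?D = "\<Sum>i<n. d i"
  have B: "?B \<in> carrier_mat ?D n" by (rule blkdiag_carrier)
  have C: "?C \<in> carrier_mat (d n) 1" using mat_of_cols_carrier(1)[of "d n" "[a n]"] by simp
  have x: "stack_vec x n \<in> carrier_vec ?D" using stack_vec_carrier[of n x d] Suc.prems by simp
  have xn: "x n \<in> carrier_vec (d n)" and an: "a n \<in> carrier_vec (d n)" using Suc.prems by auto
  have "transpose_mat (blkdiag (Suc n) d a) =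
      four_block_mat (transpose_mat ?B) (0\<^sub>m n (d n)) (0\<^sub>m 1 ?D) (transpose_mat ?C)"
    unfolding blkdiag_Suc
    by (subst transpose_four_block_mat[OF B _ _ C]) auto
  then have "transpose_mat (blkdiag (Suc n) d a) *\<^sub>v stack_vec x (Suc n) =
      (transpose_mat ?B *\<^sub>v stack_vec x n) @\<^sub>v (transpose_mat ?C *\<^sub>v x n)"
    by (simp only: stack_vec.simps)
      (subst four_block_mat_mult_vec[of _ n ?D _ "d n" _ 1], use B C x xn in auto)
  also have "\<dots> = vec n (\<lambda>i. a i \<bullet> x i) @\<^sub>v vec 1 (\<lambda>_. a n \<bullet> x n)"
    using Suc an by (intro arg_cong2[where f = append_vec]) (auto intro!: eq_vecI)
  also have "\<dots> = vec (Suc n) (\<lambda>i. a i \<bullet> x i)"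
    by (intro eq_vecI) (auto simp: less_Suc_eq)
  finally show ?case .
qed

text \<open>Reduces (R) to scalar inequalities, one per agent and constraint, which can be summed
  over the agents or established one by one.\<close>

lemma feasible_R_stack_vec:
  assumes a: "\<forall>m<M. \<forall>i<N. a m i \<in> carrier_vec (d i)" and L: "L \<in> carrier_mat N N"
    and x: "\<forall>i<N. x i \<in> carrier_vec (d i)" and y: "\<forall>m<M. y m \<in> carrier_vec N"
  shows "feasible_R N M d a b L (stack_vec x N) (stack_vec y M) \<longleftrightarrow>
    (\<forall>m<M. \<forall>i<N. a m i \<bullet> x i + (L *\<^sub>v y m) $ i + b m i \<le> 0)"
proof -
  have "vec_block (\<lambda>_. N) (stack_vec y M) m = y m" if "m < M" for m
    using vec_block_stack_vec[of M y "\<lambda>_. N" m] y that by simp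
  moreover have "stack_vec y M \<in> carrier_vec (N * M)"
    using stack_vec_carrier[of M y "\<lambda>_. N"] y by (simp add: mult.commute)
  ultimately show ?thesis
    using stack_vec_carrier[OF x] L a x y
    by (auto simp: feasible_R_def transpose_blkdiag_mult_stack_vec less_eq_vec_def
        add.assoc
        simp del: index_mult_mat_vec)
qed

text \<open>A trivial kernel forces a nonzero determinant, hence a right inverse \<open>B\<close>,
  and \<open>B *\<^sub>v c\<close> is the preimage.\<close>

lemma surj_mult_mat_vec_if_inj:
  fixes A :: "'a::field mat"
  assumes A: "A \<in> carrier_mat n n"
    and inj: "\<And>v. v \<in> carrier_vec n \<Longrightarrow> A *\<^sub>v v = 0\<^sub>v n \<Longrightarrow> v = 0\<^sub>v n"
    and c: "c \<in> carrier_vec n"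
  obtains v where "v \<in> carrier_vec n" and "A *\<^sub>v v = c"
proof -
  have "det A \<noteq> 0" using inj det_0_iff_vec_prod_zero_field[OF A] by blast
  then have "A \<in> Units (ring_mat TYPE('a) n ())" by (rule det_non_zero_imp_unit[OF A])
  then obtain B where B: "B \<in> carrier_mat n n" and AB: "A * B = 1\<^sub>m n"
    by (auto simp: Units_def ring_mat_simps)
  have "A *\<^sub>v (B *\<^sub>v c) = c"
    using assoc_mult_mat_vec[OF A B c] AB c by simp
  then show thesis using B c by (intro that[of "B *\<^sub>v c"]) auto
qed

lemma laplacian_mat_carrier: "laplacian_mat n G \<in> carrier_mat n n"
  by (simp add: laplacian_mat_def)

locale graph_on_lessThan = graph G for G :: "(nat, 'e) pre_digraph" (structure) +
  fixes n :: nat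
  assumes verts_eq: "verts G = {..<n}"
begin

text \<open>Without parallel arcs, \<open>head G\<close> is injective on the arcs leaving
  \<open>u\<close>, so counting arcs amounts to counting neighbours.\<close>

lemma out_degree_eq_card_successors: "out_degree G u = card {v. u \<rightarrow> v}"
proof -
  have "inj_on (head G) (out_arcs G u)"
    using no_multi_arcs by (auto simp: inj_on_def arc_to_ends_def)
  moreover have "head G ` out_arcs G u = {v. u \<rightarrow> v}"
    by (auto simp: arcs_ends_conv)
  ultimately show ?thesis by (metis out_degree_def card_image)
qed

text \<open>The degree contributes one copy of \<open>y $ i\<close> per neighbour, to be paired with
  the adjacency term of that neighbour.\<close>

lemma laplacian_mult_vec:
  assumes y: "y \<in> carrier_vec n" and i: "i < n"
  shows "(laplacian_mat n G *\<^sub>v y) $ i = (\<Sum>j<n. of_bool (i \<rightarrow> j) * (y $ i - y $ j))"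
proof -
  have "{v. i \<rightarrow> v} = {j \<in> {..<n}. i \<rightarrow> j}"
    using adj_in_verts verts_eq by auto
  then have deg: "real (out_degree G i) = (\<Sum>j<n. of_bool (i \<rightarrow> j))"
    by (simp add: out_degree_eq_card_successors sum.If_cases of_bool_def Int_def)
  have "(laplacian_mat n G *\<^sub>v y) $ i =
      (\<Sum>j<n. ((if i = j then real (out_degree G i) else 0) - of_bool (i \<rightarrow> j)) * y $ j)"
    using y i by (simp add: laplacian_mat_def scalar_prod_def lessThan_atLeast0 of_bool_def)
  also have "\<dots> = real (out_degree G i) * y $ i - (\<Sum>j<n. of_bool (i \<rightarrow> j) * y $ j)"
    using i by (simp add: left_diff_distrib sum_subtractf if_distrib[of "\<lambda>z. z * _"] cong: if_cong)
  also have "\<dots> = (\<Sum>j<n. of_bool (i \<rightarrow> j) * (y $ i - y $ j))"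
    by (simp add: deg sum_distrib_right right_diff_distrib sum_subtractf)
  finally show ?thesis .
qed

lemma of_bool_arc_commute: "of_bool (i \<rightarrow> j) = (of_bool (j \<rightarrow> i) :: real)"
  using arcs_ends_symmetric[OF sym_arcs] by auto

text \<open>The summand is antisymmetric under exchange of \<open>i\<close> and \<open>j\<close>, so
  the double sum equals its own negative.\<close>

lemma sum_laplacian_mult_vec:
  assumes y: "y \<in> carrier_vec n"
  shows "(\<Sum>i<n. (laplacian_mat n G *\<^sub>v y) $ i) = 0"
proof -
  define S where "S = (\<Sum>i<n. \<Sum>j<n. of_bool (i \<rightarrow> j) * (y $ i - y $ j))"
  have "S = (\<Sum>i<n. \<Sum>j<n. of_bool (j \<rightarrow> i) * (y $ j - y $ i))"
    unfolding S_def by (rule sum.swap)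
  also have "\<dots> = (\<Sum>i<n. \<Sum>j<n. - (of_bool (i \<rightarrow> j) * (y $ i - y $ j)))"
    by (intro sum.cong refl) (simp add: of_bool_arc_commute algebra_simps)
  also have "\<dots> = - S"
    unfolding S_def by (simp add: sum_negf)
  finally show ?thesis
    using laplacian_mult_vec[OF y] by (simp add: S_def)
qed

text \<open>Adding the double sum to its copy with \<open>i\<close> and \<open>j\<close> exchanged
  completes the square; the factor 2 reflects that each edge occurs in both directions.\<close>

lemma laplacian_quadratic_form:
  assumes y: "y \<in> carrier_vec n"
  shows "2 * (\<Sum>i<n. y $ i * (laplacian_mat n G *\<^sub>v y) $ i) =
    (\<Sum>i<n. \<Sum>j<n. of_bool (i \<rightarrow> j) * (y $ i - y $ j)\<^sup>2)"
proof -
  define Q where "Q = (\<Sum>i<n. \<Sum>j<n. y $ i * (of_bool (i \<rightarrow> j) * (y $ i - y $ j)))"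
  have "Q = (\<Sum>i<n. \<Sum>j<n. y $ j * (of_bool (j \<rightarrow> i) * (y $ j - y $ i)))"
    unfolding Q_def by (rule sum.swap)
  also have "\<dots> = (\<Sum>i<n. \<Sum>j<n. y $ j * (of_bool (i \<rightarrow> j) * (y $ j - y $ i)))"
    by (intro sum.cong refl arg_cong2[where f = "(*)"] of_bool_arc_commute)
  finally have "2 * Q = (\<Sum>i<n. \<Sum>j<n. y $ i * (of_bool (i \<rightarrow> j) * (y $ i - y $ j)))
      + (\<Sum>i<n. \<Sum>j<n. y $ j * (of_bool (i \<rightarrow> j) * (y $ j - y $ i)))"
    by (simp add: Q_def)
  also have "\<dots> = (\<Sum>i<n. \<Sum>j<n. of_bool (i \<rightarrow> j) * (y $ i - y $ j)\<^sup>2)"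
    unfolding sum.distrib[symmetric]
    by (intro sum.cong refl) (simp add: power2_eq_square algebra_simps)
  finally show ?thesis
    using laplacian_mult_vec[OF y] by (simp add: Q_def sum_distrib_left del: sum_of_bool_mult_eq)
qed

text \<open>A vanishing sum of squares makes \<open>y\<close> agree across every arc, and
  connectedness carries this along a path from \<open>i\<close> to \<open>j\<close>.\<close>

lemma laplacian_kernel:
  assumes conn: "Digraph_Component.connected G"
    and y: "y \<in> carrier_vec n" and Ly: "laplacian_mat n G *\<^sub>v y = 0\<^sub>v n"
    and i: "i < n" and j: "j < n"
  shows "y $ i = y $ j"
proof -
  have "(\<Sum>u<n. \<Sum>v<n. of_bool (u \<rightarrow> v) * (y $ u - y $ v)\<^sup>2) = 0"
    using laplacian_quadratic_form[OF y] Ly by simp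
  then have zero: "of_bool (u \<rightarrow> v) * (y $ u - y $ v)\<^sup>2 = 0" if "u < n" "v < n" for u v
    using that by (simp add: sum_nonneg_eq_0_iff sum_nonneg)
  have step: "y $ u = y $ v" if "u \<rightarrow> v" for u v
    using zero[of u v] adj_in_verts[OF that] verts_eq that by simp
  \<comment> \<open>\<open>connected\<close> means strong connectedness of the symmetric closure; as
    the arcs are already symmetric, reachability there is reachability in \<open>G\<close>.\<close>
  have "i \<rightarrow>\<^sup>* j"
    using conn i j verts_eq reachable_mk_symmetric_eq[OF sym_arcs]
    by (auto simp: connected_def strongly_connected_def)
  then show ?thesis
    by (induction rule: converse_reachable_induct) (auto dest: step)
qed

lemma laplacian_surj_zero_sum:
  assumes conn: "Digraph_Component.connected G"
    and c: "c \<in> carrier_vec n" and c_sum: "(\<Sum>i<n. c $ i) = 0"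
  obtains y where "y \<in> carrier_vec n" and "laplacian_mat n G *\<^sub>v y = c"
proof -
  let ?L = "laplacian_mat n G" and ?J = "mat n n (\<lambda>_. 1 :: real)"
  have L: "?L \<in> carrier_mat n n" by (rule laplacian_mat_carrier)
  have LJ: "((?L + ?J) *\<^sub>v v) $ i = (?L *\<^sub>v v) $ i + (\<Sum>j<n. v $ j)"
    if "v \<in> carrier_vec n" "i < n" for v i
    using that L add_mult_distrib_mat_vec[OF L, of ?J v]
    by (simp add: scalar_prod_def lessThan_atLeast0)
  \<comment> \<open>Used twice: with \<open>w\<close> zero for injectivity of
    \<open>?L + ?J\<close>, and with \<open>w = c\<close> to see that the solution already solves
    the system for \<open>?L\<close> alone.\<close>
  have zero_sum: "(\<Sum>j<n. v $ j) = 0" and laplacian_part: "?L *\<^sub>v v = w"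
    if v: "v \<in> carrier_vec n" and eq: "(?L + ?J) *\<^sub>v v = w" and w: "(\<Sum>i<n. w $ i) = 0"
    for v w
  proof -
    have "(\<Sum>i<n. w $ i) = (\<Sum>i<n. (?L *\<^sub>v v) $ i + (\<Sum>j<n. v $ j))"
      using LJ[OF v] eq by (intro sum.cong) auto
    then have "real n * (\<Sum>j<n. v $ j) = 0"
      using w sum_laplacian_mult_vec[OF v] by (simp add: sum.distrib)
    \<comment> \<open>If \<open>n = 0\<close>, the factor \<open>real n\<close> cannot be cancelled,
      but then the sum is empty.\<close>
    then show s: "(\<Sum>j<n. v $ j) = 0" by auto
    show "?L *\<^sub>v v = w"
      using LJ[OF v] s eq L by (intro eq_vecI) auto
  qed
  have inj: "v = 0\<^sub>v n" if v: "v \<in> carrier_vec n" and eq: "(?L + ?J) *\<^sub>v v = 0\<^sub>v n" for v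
  proof (rule eq_vecI)
    fix i assume "i < dim_vec (0\<^sub>v n :: real vec)"
    then have i: "i < n" by simp
    have "?L *\<^sub>v v = 0\<^sub>v n" using laplacian_part[OF v eq] by simp
    \<comment> \<open>Being in the kernel of \<open>?L\<close>, \<open>v\<close> is constant, so its
      sum is \<open>n\<close> times \<open>v $ i\<close>; this sum is zero and \<open>n\<close> is
      positive.\<close>
    then have "(\<Sum>j<n. v $ j) = (\<Sum>j<n. v $ i)"
      using laplacian_kernel[OF conn v _ _ i] by (intro sum.cong) auto
    then show "v $ i = 0\<^sub>v n $ i"
      using zero_sum[OF v eq] i by simp
  qed (use v in simp)
  obtain y where y: "y \<in> carrier_vec n" "(?L + ?J) *\<^sub>v y = c"
    using surj_mult_mat_vec_if_inj[of "?L + ?J" n c] inj c L by auto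
  show thesis
    using that[OF y(1) laplacian_part[OF y c_sum]] .
qed

end

theorem proposition1:
  fixes N M :: nat
    and d :: "nat \<Rightarrow> nat"
    and a :: "nat \<Rightarrow> nat \<Rightarrow> real vec"
    and b :: "nat \<Rightarrow> nat \<Rightarrow> real"
    and f :: "nat \<Rightarrow> real vec \<Rightarrow> real"
    and G :: "(nat, 'e) pre_digraph"
    and L :: "real mat"
  assumes "\<forall>m<M. \<forall>i<N. a m i \<in> carrier_vec (d i)"
    and "graph G" and "verts G = {..<N}" and "Digraph_Component.connected G"
    and "L = laplacian_mat N G"
  shows "(\<forall>x' y'. feasible_R N M d a b L x' y' \<longrightarrow> feasible_P N M d a b (vec_block d x')) \<and>
    (\<forall>x'. feasible_P N M d a b x' \<longrightarrow>
       (\<exists>y' \<in> carrier_vec (N * M). feasible_R N M d a b L (stack_vec x' N) y')) \<and>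
    (\<forall>x y. (\<forall>i<N. x i \<in> carrier_vec (d i)) \<longrightarrow> y \<in> carrier_vec (N * M) \<longrightarrow>
       cost_R N d f (stack_vec x N) y = cost_P N f x)"
proof -
  interpret graph_on_lessThan G N
    using assms(2,3) by (intro graph_on_lessThan.intro graph_on_lessThan_axioms.intro)
  note a = assms(1) and conn = assms(4)
  have L: "L \<in> carrier_mat N N" using assms(5) laplacian_mat_carrier by simp
  have "feasible_P N M d a b (vec_block d x')" if R: "feasible_R N M d a b L x' y'" for x' y'
  proof -
    let ?x = "vec_block d x'" and ?y = "vec_block (\<lambda>_. N) y'"
    have x: "\<forall>i<N. ?x i \<in> carrier_vec (d i)" and y: "\<forall>m<M. ?y m \<in> carrier_vec N"
      by (auto simp: vec_block_def)
    \<comment> \<open>Every point of (R) is the stack of its own blocks, so the scalar form of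
      feasibility applies to it.\<close>
    have "stack_vec ?x N = x'" and "stack_vec ?y M = y'"
      using R stack_vec_vec_block[of x' d N] stack_vec_vec_block[of y' "\<lambda>_. N" M]
      by (auto simp: feasible_R_def mult.commute)
    then have le: "a m i \<bullet> ?x i + (L *\<^sub>v ?y m) $ i + b m i \<le> 0" if "m < M" "i < N" for m i
      using R feasible_R_stack_vec[OF a L x y, of b] that by simp
    have "(\<Sum>i<N. a m i \<bullet> ?x i + b m i) \<le> 0" if m: "m < M" for m
    proof -
      have "(\<Sum>i<N. a m i \<bullet> ?x i + b m i) =
          (\<Sum>i<N. a m i \<bullet> ?x i + (L *\<^sub>v ?y m) $ i + b m i)"
        using sum_laplacian_mult_vec[of "?y m"] y m assms(5) by (simp add: sum.distrib)
      also have "\<dots> \<le> 0" using le[OF m] by (intro sum_nonpos) auto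
      finally show ?thesis .
    qed
    with x show ?thesis by (simp add: feasible_P_def)
  qed
  moreover have "\<exists>y' \<in> carrier_vec (N * M). feasible_R N M d a b L (stack_vec x' N) y'"
    if P: "feasible_P N M d a b x'" for x'
  proof -
    have x: "\<forall>i<N. x' i \<in> carrier_vec (d i)" using P by (simp add: feasible_P_def)
    define r where "r m i = a m i \<bullet> x' i + b m i" for m i
    have "\<exists>y. y \<in> carrier_vec N \<and> (\<forall>i<N. r m i + (L *\<^sub>v y) $ i \<le> 0)" if m: "m < M" for m
    proof -
      define s where "s = (\<Sum>i<N. r m i)"
      have s: "s \<le> 0" using P m by (simp add: feasible_P_def s_def r_def)
      \<comment> \<open>The correction that moves each \<open>r m i\<close> to the average
        \<open>s / N\<close>. The case \<open>N = 0\<close> is separate because cancelling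
        \<open>N\<close> requires it to be nonzero.\<close>
      have "(\<Sum>i<N. vec N (\<lambda>i. s / N - r m i) $ i) = 0"
        by (cases "N = 0") (simp_all add: sum_subtractf s_def)
      then obtain y where "y \<in> carrier_vec N" and "L *\<^sub>v y = vec N (\<lambda>i. s / N - r m i)"
        using laplacian_surj_zero_sum[OF conn vec_carrier] assms(5) by metis
      with s show ?thesis by (intro exI[of _ y]) (simp add: divide_nonpos_nonneg)
    qed
    \<comment> \<open>Each constraint has its own block of \<open>y\<close>, so the blocks can be
      chosen independently.\<close>
    then obtain y where y: "\<forall>m<M. y m \<in> carrier_vec N"
      and le: "\<forall>m<M. \<forall>i<N. r m i + (L *\<^sub>v y m) $ i \<le> 0"
      by metis
    have "feasible_R N M d a b L (stack_vec x' N) (stack_vec y M)"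
      unfolding feasible_R_stack_vec[OF a L x y] using le by (simp add: r_def algebra_simps)
    then show ?thesis by (auto simp: feasible_R_def)
  qed
  moreover have "cost_R N d f (stack_vec x N) y = cost_P N f x"
    if "\<forall>i<N. x i \<in> carrier_vec (d i)" for x y
    using that by (simp add: cost_R_def cost_P_def vec_block_stack_vec)
  ultimately show ?thesis by blast
qed

end
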